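(* Let $\mathbb{F}$ be a finite rank, non-abelian free group and let $S$ be a finite, symmetric free generating set of $\mathbb{F}$. Then $\mathbb{F}\times\mathbb{F}$ is growth tight with respect to the generating set $(S\cup\{1\})\times(S\cup\{1\})$.
   Context: A symmetric free generating set of $\mathbb{F}$ is a set of the form $B\cup B^{-1}$ with $B$ a free basis. Growth. For a set $A$ with a pseudo-metric $d$ and base point $a_0\in A$, the growth exponent is $\delta_{A,d}=\limsup_{r\to\infty}\frac1r\log\#\{a\in A\mid d(a_0,a)\le r\}$ (independent of the base point). If $G$ acts properly discontinuously and cocompactly by isometries on a proper based geodesic metric space $(X,d,o)$ and $N$ is a normal subgroup of $G$, then $G/N$ carries the left invariant pseudo-metric $\bar d(gN,g'N)=\min_{n,n'\in N}d(gn.o,g'n'.o)$. Write $\delta_{G/N}=\delta_{G/N,\bar d}$ and $\delta_G=\delta_{G/\{1\}}$. The action is growth tight if $\delta_G>\delta_{G/N}$ for every infinite normal subgroup $N$ of $G$. A group $G$ with finite generating set $T$ is growth tight with respect to $T$ if the action of $G$ by left multiplication on its Cayley graph with respect to $T$ is growth tight. *)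

theory Defs
  imports
    Complex_Main
    "HOL-Algebra.Coset"
    "HOL-Algebra.Generated_Groups"
    "HOL-Library.Extended_Real"
begin

section \<open>Free bases\<close>

text \<open>A word over \<open>B\<close> is a list of signed letters: \<open>(b, True)\<close> stands for \<open>b\<close>
  and \<open>(b, False)\<close> for its inverse.\<close>

definition reduced_words :: "'a set \<Rightarrow> ('a \<times> bool) list set" where
  "reduced_words B =
     {w. fst ` set w \<subseteq> B \<and>
         successively (\<lambda>x y. \<not> (fst x = fst y \<and> snd x \<noteq> snd y)) w}"

definition word_value :: "('a, 'b) monoid_scheme \<Rightarrow> ('a \<times> bool) list \<Rightarrow> 'a" where
  "word_value G w =
     foldr (\<lambda>(b, s) g. (if s then b else inv\<^bsub>G\<^esub> b) \<otimes>\<^bsub>G\<^esub> g) w \<one>\<^bsub>G\<^esub>"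

text \<open>Every element is the value of exactly one reduced word. The universal property is not
  used as the definition because it quantifies over groups on arbitrary types.\<close>

definition free_basis :: "('a, 'b) monoid_scheme \<Rightarrow> 'a set \<Rightarrow> bool" where
  "free_basis G B \<longleftrightarrow>
     B \<subseteq> carrier G \<and> (\<forall>g\<in>carrier G. \<exists>!w. w \<in> reduced_words B \<and> word_value G w = g)"

definition finite_rank_free_group :: "('a, 'b) monoid_scheme \<Rightarrow> bool" where
  "finite_rank_free_group G \<longleftrightarrow> group G \<and> (\<exists>B. finite B \<and> free_basis G B)"

definition symmetric_free_generating_set :: "('a, 'b) monoid_scheme \<Rightarrow> 'a set \<Rightarrow> bool" where
  "symmetric_free_generating_set G S \<longleftrightarrow>
     (\<exists>B. free_basis G B \<and> S = B \<union> (\<lambda>b. inv\<^bsub>G\<^esub> b) ` B)"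


section \<open>Growth exponents and growth tight actions\<close>

text \<open>The case distinction is needed because \<open>card\<close> is 0 on infinite sets.\<close>

definition growth_exponent :: "'c set \<Rightarrow> ('c \<Rightarrow> 'c \<Rightarrow> real) \<Rightarrow> 'c \<Rightarrow> ereal" where
  "growth_exponent A d a0 =
     Limsup at_top (\<lambda>r::real.
       if finite {a \<in> A. d a0 a \<le> r}
       then ereal (1 / r * ln (real (card {a \<in> A. d a0 a \<le> r})))
       else \<infinity>)"

text \<open>The group acts on a metric space with metric \<open>d\<close> and base point \<open>p\<close>. As the cosets
  \<open>C = gN\<close> and \<open>D = g'N\<close> are sets of group elements, the elements \<open>gn\<close> and \<open>g'n'\<close> are just
  the members of \<open>C\<close> and \<open>D\<close>. For a properly discontinuous action on a proper space the
  infimum is attained.\<close>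

definition quotient_dist ::
  "('a \<Rightarrow> 'x \<Rightarrow> 'x) \<Rightarrow> ('x \<Rightarrow> 'x \<Rightarrow> real) \<Rightarrow> 'x \<Rightarrow> 'a set \<Rightarrow> 'a set \<Rightarrow> real" where
  "quotient_dist act d p C D = Inf {d (act g p) (act h p) | g h. g \<in> C \<and> h \<in> D}"

definition quotient_growth_exponent ::
  "('a, 'b) monoid_scheme \<Rightarrow> ('a \<Rightarrow> 'x \<Rightarrow> 'x) \<Rightarrow> ('x \<Rightarrow> 'x \<Rightarrow> real) \<Rightarrow> 'x \<Rightarrow> 'a set \<Rightarrow> ereal" where
  "quotient_growth_exponent G act d p N =
     growth_exponent (carrier (G Mod N)) (quotient_dist act d p) N"

definition growth_tight_action ::
  "('a, 'b) monoid_scheme \<Rightarrow> ('a \<Rightarrow> 'x \<Rightarrow> 'x) \<Rightarrow> ('x \<Rightarrow> 'x \<Rightarrow> real) \<Rightarrow> 'x \<Rightarrow> bool" where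
  "growth_tight_action G act d p \<longleftrightarrow>
     (\<forall>N. N \<lhd> G \<and> infinite N \<longrightarrow>
        quotient_growth_exponent G act d p {\<one>\<^bsub>G\<^esub>} > quotient_growth_exponent G act d p N)"


section \<open>Cayley graphs\<close>

text \<open>Edges of the Cayley graph, as a symmetric relation on its vertex set \<open>carrier G\<close>.\<close>

definition cayley_edges :: "('a, 'b) monoid_scheme \<Rightarrow> 'a set \<Rightarrow> ('a \<times> 'a) set" where
  "cayley_edges G T =
     {(g, h). g \<in> carrier G \<and> h \<in> carrier G \<and>
              (\<exists>t\<in>T. h = g \<otimes>\<^bsub>G\<^esub> t \<or> g = h \<otimes>\<^bsub>G\<^esub> t)}"

text \<open>Path metric on the vertices, each edge having length 1: the least \<open>n\<close> for which there
  is an edge path of length \<open>n\<close>. The definition of growth tightness only evaluates the metric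
  on the orbit of the base point, which for the base point \<open>\<one>\<close> is the vertex set, so the
  interior points of the edges of the geometric realisation are not represented.\<close>

definition cayley_dist :: "('a, 'b) monoid_scheme \<Rightarrow> 'a set \<Rightarrow> 'a \<Rightarrow> 'a \<Rightarrow> real" where
  "cayley_dist G T g h = real (LEAST n. (g, h) \<in> cayley_edges G T ^^ n)"

definition growth_tight_wrt :: "('a, 'b) monoid_scheme \<Rightarrow> 'a set \<Rightarrow> bool" where
  "growth_tight_wrt G T \<longleftrightarrow>
     finite T \<and> T \<subseteq> carrier G \<and> generate G T = carrier G \<and>
     growth_tight_action G (\<lambda>g x. g \<otimes>\<^bsub>G\<^esub> x) (cayley_dist G T) \<one>\<^bsub>G\<^esub>"

end

theory Submission
  imports Defs "HOL-Library.Sublist" "HOL-Real_Asymp.Real_Asymp"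
begin

text \<open>The word length of \<open>(x, y)\<close> is the maximum of the lengths of \<open>x\<close> and \<open>y\<close>, so the growth
  exponent of the product is \<open>2 ln q\<close> with \<open>q = 2 k - 1\<close> for rank \<open>k\<close>. As the free group has
  trivial centre, a commutator shows that a nontrivial normal subgroup \<open>N\<close> contains \<open>(a, 1)\<close> or
  \<open>(1, a)\<close> with \<open>a \<noteq> 1\<close>. Hence every coset of \<open>N\<close> has a shortest representative one coordinate of
  which avoids the reduced word of \<open>a\<close> as a factor, and the number of such words of length \<open>n\<close> is
  at most \<open>K \<rho>\<^sup>n\<close> with \<open>\<rho> < q\<close>. So the quotient has growth exponent at most
  \<open>ln \<rho> + ln q < 2 ln q\<close>.\<close>

section \<open>Reduced words avoiding a factor\<close>

definition flip_sign :: "'a \<times> bool \<Rightarrow> 'a \<times> bool" where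
  "flip_sign x = (fst x, \<not> snd x)"

lemma fst_flip_sign [simp]: "fst (flip_sign x) = fst x"
  by (simp add: flip_sign_def)

lemma eq_flip_sign_commute: "x = flip_sign y \<longleftrightarrow> y = flip_sign x"
  by (cases x; cases y) (auto simp: flip_sign_def)

text \<open>In terms of \<open>flip_sign\<close>, reducedness is a condition on neighbouring letters
  to which the rules for \<open>successively\<close> apply directly.\<close>

lemma reduced_words_eq:
  "reduced_words B = {w. fst ` set w \<subseteq> B \<and> successively (\<lambda>x y. y \<noteq> flip_sign x) w}"
  by (auto simp: reduced_words_def flip_sign_def prod_eq_iff elim!: successively_mono)

lemma Nil_in_reduced_words [simp]: "[] \<in> reduced_words B"
  by (simp add: reduced_words_eq)

lemma Cons_in_reduced_words_iff:
  "x # z \<in> reduced_words B \<longleftrightarrow>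
     fst x \<in> B \<and> z \<in> reduced_words B \<and> (z = [] \<or> hd z \<noteq> flip_sign x)"
  by (auto simp: reduced_words_eq successively_Cons)

lemma append_in_reduced_words_iff:
  "u @ v \<in> reduced_words B \<longleftrightarrow>
     u \<in> reduced_words B \<and> v \<in> reduced_words B \<and>
     (u = [] \<or> v = [] \<or> hd v \<noteq> flip_sign (last u))"
  by (auto simp: reduced_words_eq successively_append_iff)

lemma not_reduced_word_split:
  assumes "fst ` set u \<subseteq> B" "u \<notin> reduced_words B"
  obtains u1 x u2 where "u = u1 @ [x, flip_sign x] @ u2"
  using assms
proof (induction u arbitrary: thesis)
  case (Cons x u)
  show ?case
  proof (cases "u \<in> reduced_words B")
    case True
    then have "u \<noteq> []" "hd u = flip_sign x"
      using Cons.prems by (auto simp: Cons_in_reduced_words_iff)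
    then have "x # u = [] @ [x, flip_sign x] @ tl u"
      by (cases u) auto
    then show ?thesis by (rule Cons.prems)
  next
    case False
    moreover have "fst ` set u \<subseteq> B" using Cons.prems by auto
    ultimately obtain u1 y u2 where "u = u1 @ [y, flip_sign y] @ u2"
      using Cons.IH by blast
    then have "x # u = (x # u1) @ [y, flip_sign y] @ u2" by simp
    then show ?thesis by (rule Cons.prems)
  qed
qed simp

text \<open>Rank b gives 2b signed letters. From rank 2 on there are at least four, so the two or
  three forbidden letters that occur below always leave a choice.\<close>

lemma letter_avoiding:
  fixes X :: "('a \<times> bool) set"
  assumes "finite B" "finite X" "card X < 2 * card B"
  obtains x where "fst x \<in> B" "x \<notin> X"
proof -
  have "card (B \<times> (UNIV :: bool set)) = 2 * card B"
    by (simp add: card_cartesian_product)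
  with assms have "\<not> B \<times> (UNIV :: bool set) \<subseteq> X"
    by (metis card_mono not_less)
  then obtain x where "x \<in> B \<times> (UNIV :: bool set)" "x \<notin> X"
    by blast
  with that show ?thesis by (metis mem_Times_iff)
qed

section \<open>Counting reduced words by extension to the left\<close>

definition extensions :: "'a set \<Rightarrow> ('a \<times> bool) list \<Rightarrow> nat \<Rightarrow> ('a \<times> bool) list set" where
  "extensions B u n = {v. length v = n \<and> v @ u \<in> reduced_words B}"

text \<open>Only the inverse of the first letter of \<open>z\<close> is excluded as a new first
  letter. The empty word would exclude nothing, hence \<open>z \<noteq> []\<close>.\<close>

lemma card_reduced_Cons:
  assumes "finite B" "z \<in> reduced_words B" "z \<noteq> []"
  shows "finite {x. x # z \<in> reduced_words B}"
    and "card {x. x # z \<in> reduced_words B} = 2 * card B - 1"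
proof -
  have hd: "fst (hd z) \<in> B"
    using assms by (cases z) (auto simp: Cons_in_reduced_words_iff)
  have "{x. x # z \<in> reduced_words B} = B \<times> UNIV - {flip_sign (hd z)}"
    using assms by (auto simp: Cons_in_reduced_words_iff eq_flip_sign_commute[of "hd z"])
  moreover have "flip_sign (hd z) \<in> B \<times> UNIV"
    using hd by (simp add: mem_Times_iff)
  ultimately show "finite {x. x # z \<in> reduced_words B}"
    and "card {x. x # z \<in> reduced_words B} = 2 * card B - 1"
    using assms(1) by (simp_all add: card_cartesian_product)
qed

text \<open>Prepending one letter multiplies the count by \<open>2 * card B - 1\<close>, whatever
  word has been reached.\<close>

lemma card_extensions:
  assumes "finite B" "u \<in> reduced_words B" "u \<noteq> []"
  shows "finite (extensions B u n) \<and> card (extensions B u n) = (2 * card B - 1) ^ n"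
proof (induction n)
  case 0
  have "extensions B u 0 = {[]}" using assms by (auto simp: extensions_def)
  then show ?case by simp
next
  case (Suc n)
  let ?X = "SIGMA v:extensions B u n. {x. x # v @ u \<in> reduced_words B}"
  have eq: "extensions B u (Suc n) = (\<lambda>(v, x). x # v) ` ?X"
    by (force simp: extensions_def length_Suc_conv image_iff Cons_in_reduced_words_iff)
  have fib: "finite {x. x # v @ u \<in> reduced_words B}"
    "card {x. x # v @ u \<in> reduced_words B} = 2 * card B - 1" if "v \<in> extensions B u n" for v
    using card_reduced_Cons[OF assms(1), of "v @ u"] that assms(3) by (auto simp: extensions_def)
  have "card ?X = (2 * card B - 1) ^ n * (2 * card B - 1)"
    using Suc fib by simp
  moreover have "card (extensions B u (Suc n)) = card ?X"
    unfolding eq by (rule card_image) (auto simp: inj_on_def)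
  moreover have "finite ?X" using Suc fib by (intro finite_SigmaI) auto
  ultimately show ?case unfolding eq by simp
qed

text \<open>The last letter is free, with \<open>2 * card B\<close> choices; the remaining
  \<open>n\<close> letters form an extension of it to the left.\<close>

lemma card_reduced_words_length:
  assumes "finite B"
  shows "finite {u \<in> reduced_words B. length u = Suc n}"
    and "card {u \<in> reduced_words B. length u = Suc n} = 2 * card B * (2 * card B - 1) ^ n"
proof -
  let ?X = "SIGMA x:B \<times> UNIV. extensions B [x] n"
  have eq: "{u \<in> reduced_words B. length u = Suc n} = (\<lambda>(x, v). v @ [x]) ` ?X"
  proof (intro equalityI subsetI)
    fix u assume u: "u \<in> {u \<in> reduced_words B. length u = Suc n}"
    then obtain v x where vx: "u = v @ [x]" by (cases u rule: rev_cases) auto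
    with u have "fst x \<in> B"
      by (simp add: append_in_reduced_words_iff Cons_in_reduced_words_iff)
    with u vx have "(x, v) \<in> ?X"
      by (simp add: extensions_def mem_Times_iff)
    with vx show "u \<in> (\<lambda>(x, v). v @ [x]) ` ?X" by force
  qed (auto simp: extensions_def)
  have fib: "finite (extensions B [x] n)" "card (extensions B [x] n) = (2 * card B - 1) ^ n"
    if "x \<in> B \<times> UNIV" for x
    using card_extensions[OF assms, of "[x]" n] that
    by (auto simp: Cons_in_reduced_words_iff mem_Times_iff)
  have "card ?X = 2 * card B * (2 * card B - 1) ^ n"
    using assms fib by (simp add: card_cartesian_product)
  moreover have "card ((\<lambda>(x, v). v @ [x]) ` ?X) = card ?X"
    by (rule card_image) (auto simp: inj_on_def)
  moreover have "finite ?X" using assms fib by (intro finite_SigmaI) auto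
  ultimately show "finite {u \<in> reduced_words B. length u = Suc n}"
    and "card {u \<in> reduced_words B. length u = Suc n} = 2 * card B * (2 * card B - 1) ^ n"
    unfolding eq by simp_all
qed

section \<open>Exponential gap for words avoiding a factor\<close>

definition avoiding_words :: "'a set \<Rightarrow> ('a \<times> bool) list \<Rightarrow> nat \<Rightarrow> ('a \<times> bool) list set" where
  "avoiding_words B w n = {u \<in> reduced_words B. length u = n \<and> \<not> sublist w u}"

lemma finite_reduced_words_length:
  "finite B \<Longrightarrow> finite {u \<in> reduced_words B. length u = n}"
  by (cases n) (auto simp: card_reduced_words_length)

lemma finite_avoiding_words: "finite B \<Longrightarrow> finite (avoiding_words B w n)"
  by (rule finite_subset[OF _ finite_reduced_words_length[of B n]]) (auto simp: avoiding_words_def)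

text \<open>A word \<open>u\<close> can be extended to the left by \<open>w\<close> followed by a letter that cancels neither
  with \<open>w\<close> nor with \<open>u\<close>, so at least one of the extensions of \<open>u\<close> is lost.\<close>

lemma card_avoiding_words_step:
  assumes B: "finite B" "2 \<le> card B" and w: "w \<in> reduced_words B" "w \<noteq> []"
  shows "card (avoiding_words B w (Suc n + Suc (length w))) \<le>
    ((2 * card B - 1) ^ Suc (length w) - 1) * card (avoiding_words B w (Suc n))"
proof -
  let ?A = "avoiding_words B w (Suc n)"
  let ?m = "Suc (length w)"
  have "\<exists>x. fst x \<in> B \<and> w @ [x] @ u \<in> reduced_words B" if u: "u \<in> ?A" for u
  proof -
    have "card {flip_sign (last w), flip_sign (hd u)} \<le> 2"
      by (simp add: card_insert_if)
    with B have "card {flip_sign (last w), flip_sign (hd u)} < 2 * card B" by simp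
    then obtain x where "fst x \<in> B" "x \<notin> {flip_sign (last w), flip_sign (hd u)}"
      by (rule letter_avoiding[OF B(1), rotated]) auto
    with u w show ?thesis
      by (intro exI[of _ x]) (auto simp: avoiding_words_def append_in_reduced_words_iff Cons_in_reduced_words_iff
        eq_flip_sign_commute[of "hd u"])
  qed
  then obtain x where x: "\<And>u. u \<in> ?A \<Longrightarrow> w @ [x u] @ u \<in> reduced_words B"
    by metis
  \<comment> \<open>From the extensions of each \<open>u\<close> by \<open>?m\<close> letters, the
    one that begins with \<open>w\<close> is taken out.\<close>
  let ?X = "SIGMA u:?A. extensions B u ?m - {w @ [x u]}"
  have A: "u \<in> reduced_words B" "u \<noteq> []" if "u \<in> ?A" for u
    using that by (auto simp: avoiding_words_def)
  have fib: "finite (extensions B u ?m - {w @ [x u]})"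
      "card (extensions B u ?m - {w @ [x u]}) = (2 * card B - 1) ^ ?m - 1" if "u \<in> ?A" for u
    using card_extensions[OF B(1) A[OF that]] x[OF that]
    by (auto simp: extensions_def simp del: power_Suc)
  have fin: "finite ?X"
    using fib finite_avoiding_words[OF B(1)] by (intro finite_SigmaI) auto
  \<comment> \<open>Cut off the first \<open>?m\<close> letters: the rest is a factor of the word
    and still avoids \<open>w\<close>, and the block cut off cannot be
    \<open>w @ [x u]\<close>.\<close>
  have "avoiding_words B w (Suc n + ?m) \<subseteq> (\<lambda>(u, v). v @ u) ` ?X"
  proof
    fix y assume y: "y \<in> avoiding_words B w (Suc n + ?m)"
    define u v where "u = drop ?m y" and "v = take ?m y"
    have yuv: "y = v @ u" by (simp add: u_def v_def)
    have len: "length u = Suc n" "length v = ?m"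
      using y by (auto simp: u_def v_def avoiding_words_def)
    have red: "y \<in> reduced_words B" and av: "\<not> sublist w y"
      using y by (auto simp: avoiding_words_def)
    have "\<not> sublist w u" using av unfolding yuv by (metis sublist_append)
    moreover have "v \<noteq> w @ [x u]"
      using av unfolding yuv by (metis sublist_append sublist_order.order_refl)
    moreover have "u \<in> reduced_words B"
      using red unfolding yuv by (simp add: append_in_reduced_words_iff)
    ultimately have "(u, v) \<in> ?X"
      using len red unfolding yuv by (auto simp: avoiding_words_def extensions_def)
    then show "y \<in> (\<lambda>(u, v). v @ u) ` ?X" unfolding yuv by force
  qed
  then have "card (avoiding_words B w (Suc n + ?m)) \<le> card ?X"
    using fin by (meson surj_card_le)
  also have "\<dots> = ((2 * card B - 1) ^ ?m - 1) * card ?A"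
    using fib finite_avoiding_words[OF B(1)] by simp
  finally show ?thesis .
qed

text \<open>With m = length w + 1 and q = 2 card B - 1, each further block of m letters multiplies
  the count by at most q^m - 1. Spreading the loss evenly over the block gives the rate \<rho>, the
  m-th root of q^m - 1, which lies below q.\<close>

lemma card_avoiding_words_bound:
  assumes B: "finite B" "2 \<le> card B" and w: "w \<in> reduced_words B" "w \<noteq> []"
  obtains K \<rho> :: real where "1 \<le> K" "1 \<le> \<rho>" "\<rho> < 2 * card B - 1"
    "\<And>n. card (avoiding_words B w n) \<le> K * \<rho> ^ n"
proof -
  define m where "m = Suc (length w)"
  define q where "q = 2 * card B - 1"
  define \<rho> where "\<rho> = root m (q ^ m - 1)"
  \<comment> \<open>The sum dominates all counts up to length \<open>m\<close>, the base of the
    induction; the summand 1 ensures \<open>1 \<le> K\<close> whatever these counts are.\<close>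
  define K where "K = 1 + (\<Sum>i\<le>m. real (card (avoiding_words B w i)))"
  have q: "3 \<le> q" and rq: "real q = 2 * card B - 1" using B(2) by (auto simp: q_def of_nat_diff)
  have m: "0 < m" by (simp add: m_def)
  have "3 ^ 1 \<le> (3::nat) ^ m" using m by (intro power_increasing) auto
  also have "\<dots> \<le> q ^ m" using q by (intro power_mono) auto
  finally have qm: "3 \<le> q ^ m" by simp
  then have qm': "3 \<le> real q ^ m" by (metis of_nat_le_iff of_nat_numeral of_nat_power)
  have qm1: "real (q ^ m - 1) = real q ^ m - 1"
    using qm by (subst of_nat_diff) auto
  have \<rho>m: "\<rho> ^ m = real q ^ m - 1"
    unfolding \<rho>_def qm1[symmetric] using m by (intro real_root_pow_pos2) auto
  have \<rho>1: "1 \<le> \<rho>" unfolding \<rho>_def qm1 using m qm' by (simp add: real_root_ge_1_iff)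
  have "\<rho> ^ m < real q ^ m" using \<rho>m by simp
  then have \<rho>q: "\<rho> < real q" by (rule power_less_imp_less_base) simp
  have K1: "1 \<le> K" by (simp add: K_def sum_nonneg)
  have "card (avoiding_words B w n) \<le> K * \<rho> ^ n" for n
  proof (induction n rule: less_induct)
    case (less n)
    show ?case
    proof (cases "n \<le> m")
      case True
      have "real (card (avoiding_words B w n)) \<le> (\<Sum>i\<le>m. real (card (avoiding_words B w i)))"
        using True by (intro member_le_sum) auto
      also have "\<dots> \<le> K * 1" by (simp add: K_def)
      also have "\<dots> \<le> K * \<rho> ^ n" using K1 \<rho>1 by (intro mult_left_mono) auto
      finally show ?thesis .
    next
      case False
      \<comment> \<open>More than \<open>m\<close> letters leave a non-empty rest, as the step
        estimate requires.\<close>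
      then obtain k where n: "n = Suc k + m"
        by (metis add.commute add_Suc_right less_imp_Suc_add not_le)
      have "card (avoiding_words B w n) \<le> (q ^ m - 1) * card (avoiding_words B w (Suc k))"
        using card_avoiding_words_step[OF assms, of k] unfolding n m_def q_def by simp
      then have "real (card (avoiding_words B w n)) \<le>
          real ((q ^ m - 1) * card (avoiding_words B w (Suc k)))"
        by (simp only: of_nat_le_iff)
      also have "\<dots> = \<rho> ^ m * card (avoiding_words B w (Suc k))"
        by (simp only: of_nat_mult qm1 \<rho>m)
      also have "\<dots> \<le> \<rho> ^ m * (K * \<rho> ^ Suc k)"
        using less[of "Suc k"] n m \<rho>1 by (intro mult_left_mono) auto
      also have "\<dots> = K * \<rho> ^ n" unfolding n by (simp add: power_add)
      finally show ?thesis .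
    qed
  qed
  with that K1 \<rho>1 \<rho>q rq show ?thesis by metis
qed

section \<open>Estimates of growth exponents\<close>

text \<open>Since \<rho> is at least 1, the last of the n + 1 bounds is the largest. The resulting
  linear factor does not affect the exponential rate.\<close>

lemma card_UN_le_geometric:
  fixes K \<rho> :: real
  assumes "\<And>i. card (X i) \<le> K * \<rho> ^ i" "0 \<le> K" "1 \<le> \<rho>"
  shows "card (\<Union>i\<le>n. X i) \<le> K * (real n + 1) * \<rho> ^ n"
proof -
  have "real (card (\<Union>i\<le>n. X i)) \<le> real (\<Sum>i\<le>n. card (X i))"
    by (subst of_nat_le_iff) (rule card_UN_le, simp)
  also have "\<dots> \<le> (\<Sum>i\<le>n. K * \<rho> ^ n)"
    unfolding of_nat_sum
  proof (rule sum_mono)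
    fix i assume "i \<in> {..n}"
    then have "K * \<rho> ^ i \<le> K * \<rho> ^ n"
      using assms(2,3) by (intro mult_left_mono power_increasing) auto
    with assms(1)[of i] show "real (card (X i)) \<le> K * \<rho> ^ n" by linarith
  qed
  finally show ?thesis by (simp add: algebra_simps)
qed

text \<open>The factors \<open>K\<close> and \<open>(real n + 1) ^ k\<close> vanish after taking
  logarithms and dividing by the radius. Integral radii suffice because a real radius can be rounded
  up.\<close>

lemma growth_exponent_le:
  fixes K L :: real and k :: nat
  assumes K: "1 \<le> K" and L: "1 \<le> L"
    and fin: "\<And>n::nat. finite {a \<in> A. d a0 a \<le> real n}"
    and card: "\<And>n::nat. card {a \<in> A. d a0 a \<le> real n} \<le> K * (real n + 1) ^ k * L ^ n"
  shows "growth_exponent A d a0 \<le> ereal (ln L)"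
proof -
  \<comment> \<open>Rounding up gives n \<le> r + 1, whence \<open>r + 2\<close> and
    \<open>r + 1\<close>.\<close>
  define f where "f r = 1 / r * (ln K + k * ln (r + 2) + (r + 1) * ln L)" for r :: real
  have "eventually (\<lambda>r. (if finite {a \<in> A. d a0 a \<le> r}
       then ereal (1 / r * ln (real (card {a \<in> A. d a0 a \<le> r}))) else \<infinity>) \<le> ereal (f r)) at_top"
    using eventually_ge_at_top[of "1::real"]
  proof eventually_elim
    case (elim r)
    define n where "n = nat \<lceil>r\<rceil>"
    have n: "r \<le> n" "n \<le> r + 1" using elim unfolding n_def by linarith+
    have sub: "{a \<in> A. d a0 a \<le> r} \<subseteq> {a \<in> A. d a0 a \<le> real n}" using n by auto
    then have fin': "finite {a \<in> A. d a0 a \<le> r}" using fin finite_subset by blast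
    let ?c = "card {a \<in> A. d a0 a \<le> r}"
    have "?c \<le> card {a \<in> A. d a0 a \<le> real n}" using sub fin by (rule card_mono[rotated])
    then have "real ?c \<le> K * (real n + 1) ^ k * L ^ n"
      using card[of n] by linarith
    also have "\<dots> \<le> K * (r + 2) ^ k * L powr (r + 1)"
      using n K L elim by (intro mult_mono power_mono)
        (auto simp: powr_realpow[symmetric] intro!: powr_mono)
    finally have le: "real ?c \<le> K * (r + 2) ^ k * L powr (r + 1)" .
    have ln: "ln (K * (r + 2) ^ k * L powr (r + 1)) = ln K + k * ln (r + 2) + (r + 1) * ln L"
      using K L elim by (simp add: ln_mult ln_realpow ln_powr)
    \<comment> \<open>An empty ball has \<open>ln 0 = 0\<close>, so that case only asks for a
      nonnegative bound.\<close>
    have "ln (real ?c) \<le> ln K + k * ln (r + 2) + (r + 1) * ln L"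
    proof (cases "?c = 0")
      case False
      with le show ?thesis unfolding ln[symmetric] by (intro ln_mono) auto
    qed (use K L elim in simp)
    then show ?case
      using fin' elim by (simp add: f_def divide_right_mono)
  qed
  then have "growth_exponent A d a0 \<le> Limsup at_top (\<lambda>r. ereal (f r))"
    unfolding growth_exponent_def by (rule Limsup_mono)
  also have "(f \<longlongrightarrow> ln L) at_top"
    unfolding f_def by real_asymp
  then have "Limsup at_top (\<lambda>r. ereal (f r)) = ereal (ln L)"
    by (intro lim_imp_Limsup) auto
  finally show ?thesis .
qed

text \<open>Here the radius is rounded down, at the cost of one unit. An infinite ball contributes
  \<infinity> and meets any lower bound, so the count is required for finite balls only.\<close>

lemma growth_exponent_ge:
  fixes L :: real
  assumes L: "1 \<le> L"
    and card: "\<And>n::nat. finite {a \<in> A. d a0 a \<le> real n} \<Longrightarrow>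
      L ^ n \<le> card {a \<in> A. d a0 a \<le> real n}"
  shows "ereal (ln L) \<le> growth_exponent A d a0"
proof -
  define f where "f r = 1 / r * ((r - 1) * ln L)" for r :: real
  have "eventually (\<lambda>r. ereal (f r) \<le> (if finite {a \<in> A. d a0 a \<le> r}
       then ereal (1 / r * ln (real (card {a \<in> A. d a0 a \<le> r}))) else \<infinity>)) at_top"
    using eventually_ge_at_top[of "1::real"]
  proof eventually_elim
    case (elim r)
    define n where "n = nat \<lfloor>r\<rfloor>"
    have n: "n \<le> r" "r - 1 \<le> n" using elim unfolding n_def by linarith+
    have "(r - 1) * ln L \<le> ln (real (card {a \<in> A. d a0 a \<le> r}))"
      if fin: "finite {a \<in> A. d a0 a \<le> r}"
    proof -
      have sub: "{a \<in> A. d a0 a \<le> real n} \<subseteq> {a \<in> A. d a0 a \<le> r}" using n by auto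
      then have "L ^ n \<le> card {a \<in> A. d a0 a \<le> real n}"
        using fin finite_subset by (intro card) blast
      also have "\<dots> \<le> card {a \<in> A. d a0 a \<le> r}"
        using card_mono[OF fin sub] by simp
      finally have "ln (L ^ n) \<le> ln (card {a \<in> A. d a0 a \<le> r})"
        using L by (intro ln_mono) auto
      moreover have "(r - 1) * ln L \<le> real n * ln L"
        using n L by (intro mult_right_mono) auto
      ultimately show ?thesis using L by (simp add: ln_realpow)
    qed
    then show ?case
      using elim by (simp add: f_def divide_right_mono)
  qed
  then have "Limsup at_top (\<lambda>r. ereal (f r)) \<le> growth_exponent A d a0"
    unfolding growth_exponent_def by (rule Limsup_mono)
  also have "(f \<longlongrightarrow> ln L) at_top"
    unfolding f_def by real_asymp
  then have "Limsup at_top (\<lambda>r. ereal (f r)) = ereal (ln L)"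
    by (intro lim_imp_Limsup) auto
  finally show ?thesis .
qed

section \<open>The square of a free group and its Cayley graph\<close>

text \<open>Splitting the letter off the fold lets \<open>word_value\<close> be unfolded one letter
  at a time.\<close>

definition letter_value :: "('a, 'b) monoid_scheme \<Rightarrow> 'a \<times> bool \<Rightarrow> 'a" where
  "letter_value G x = (if snd x then fst x else inv\<^bsub>G\<^esub> (fst x))"

lemma word_value_Nil [simp]: "word_value G [] = \<one>\<^bsub>G\<^esub>"
  and word_value_Cons [simp]:
    "word_value G (x # w) = letter_value G x \<otimes>\<^bsub>G\<^esub> word_value G w"
  by (simp_all add: word_value_def letter_value_def split_beta)

locale free_group_on_finite_basis = group F for F :: "('a, 'b) monoid_scheme" (structure) +
  fixes B :: "'a set"
  assumes free_basis: "free_basis F B"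
    and finite_basis: "finite B"
    and two_le_rank: "2 \<le> card B"
begin

abbreviation "words \<equiv> {w. fst ` set w \<subseteq> B}"

lemma basis_subset: "B \<subseteq> carrier F"
  using free_basis by (simp add: free_basis_def)

lemma reduced_in_words: "w \<in> reduced_words B \<Longrightarrow> w \<in> words"
  by (simp add: reduced_words_def)

lemma letter_value_closed [simp]: "fst x \<in> B \<Longrightarrow> letter_value F x \<in> carrier F"
  using basis_subset by (auto simp: letter_value_def)

lemma letter_value_flip_sign: "fst x \<in> B \<Longrightarrow> letter_value F (flip_sign x) = inv (letter_value F x)"
  using basis_subset by (auto simp: letter_value_def flip_sign_def)

lemma word_value_closed [simp]: "w \<in> words \<Longrightarrow> word_value F w \<in> carrier F"
  by (induction w) auto

lemma word_value_append:
  "u \<in> words \<Longrightarrow> v \<in> words \<Longrightarrow> word_value F (u @ v) = word_value F u \<otimes> word_value F v"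
  by (induction u) (auto simp: m_assoc)

lemma exists_reduced_word:
  "g \<in> carrier F \<Longrightarrow> \<exists>w\<in>reduced_words B. word_value F w = g"
  using free_basis by (auto simp: free_basis_def)

lemma word_value_inj_on: "inj_on (word_value F) (reduced_words B)"
proof (rule inj_onI)
  fix u v assume "u \<in> reduced_words B" "v \<in> reduced_words B" "word_value F u = word_value F v"
  moreover from this have "word_value F v \<in> carrier F"
    using reduced_in_words word_value_closed by blast
  ultimately show "u = v" using free_basis unfolding free_basis_def by metis
qed

text \<open>A shortest word with value in \<open>C\<close> is reduced, since cancelling a pair of
  inverse letters keeps the value. Minimality is stated against all words because deleting a factor
  from a reduced word may leave a non-reduced one.\<close>

lemma shortest_word:
  assumes "w \<in> words" "word_value F w \<in> C"
  obtains u where "u \<in> reduced_words B" "word_value F u \<in> C" "length u \<le> length w"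
    "\<And>v. v \<in> words \<Longrightarrow> word_value F v \<in> C \<Longrightarrow> length u \<le> length v"
proof -
  let ?P = "\<lambda>u. u \<in> words \<and> word_value F u \<in> C"
  define u where "u = arg_min length ?P"
  have u: "u \<in> words" "word_value F u \<in> C"
    and min: "\<And>v. ?P v \<Longrightarrow> length u \<le> length v"
    using arg_min_nat_lemma[of ?P w length] assms by (auto simp: u_def)
  have "u \<in> reduced_words B"
  proof (rule ccontr)
    assume "u \<notin> reduced_words B"
    then obtain u1 x u2 where eq: "u = u1 @ [x, flip_sign x] @ u2"
      using u(1) not_reduced_word_split[of u B] by blast
    have w: "u1 \<in> words" "u2 \<in> words" "fst x \<in> B" using u(1) eq by auto
    then have "word_value F [x, flip_sign x] = \<one>"
      by (simp add: letter_value_flip_sign)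
    then have "word_value F ([x, flip_sign x] @ u2) = word_value F u2"
      using w by (subst word_value_append) auto
    then have "word_value F u = word_value F (u1 @ u2)"
      unfolding eq using w by (subst (1 2) word_value_append) auto
    then have "length u \<le> length (u1 @ u2)" using w u by (intro min) auto
    then show False by (simp add: eq)
  qed
  with u min assms show ?thesis by (intro that) auto
qed

text \<open>A suitable letter before and after the reduced word of \<open>a\<close> yields two
  different reduced words, hence different values.\<close>

lemma center_trivial:
  assumes a: "a \<in> carrier F" "a \<noteq> \<one>"
  obtains c where "c \<in> carrier F" "c \<otimes> a \<noteq> a \<otimes> c"
proof -
  obtain w where w: "w \<in> reduced_words B" "word_value F w = a"
    using exists_reduced_word a by blast
  with a have ne: "w \<noteq> []" by auto
  \<comment> \<open>The three exclusions keep \<open>x # w\<close> and \<open>w @ [x]\<close>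
    reduced and make their first letters differ.\<close>
  have "card {flip_sign (hd w), flip_sign (last w), hd w} < 2 * card B"
    using two_le_rank by (simp add: card_insert_if)
  then obtain x where x: "fst x \<in> B" "x \<notin> {flip_sign (hd w), flip_sign (last w), hd w}"
    by (rule letter_avoiding[OF finite_basis, rotated]) auto
  have red: "x # w \<in> reduced_words B" "w @ [x] \<in> reduced_words B"
    using w x ne by (auto simp: Cons_in_reduced_words_iff append_in_reduced_words_iff
      eq_flip_sign_commute[of "hd w"])
  have "x # w \<noteq> w @ [x]" using x ne by (cases w) auto
  then have "word_value F (x # w) \<noteq> word_value F (w @ [x])"
    using red inj_onD[OF word_value_inj_on] by blast
  moreover have "w \<in> words" using w reduced_in_words by simp
  ultimately have "letter_value F x \<otimes> a \<noteq> a \<otimes> letter_value F x"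
    using w x by (simp add: word_value_append)
  moreover have "letter_value F x \<in> carrier F" using x by simp
  ultimately show ?thesis by (rule that[rotated])
qed

section \<open>The generating set and edge paths\<close>

definition symmetric_basis :: "'a set" where
  "symmetric_basis = B \<union> (\<lambda>b. inv b) ` B"

abbreviation FF :: "('a \<times> 'a) monoid" where
  "FF \<equiv> F \<times>\<times> F"

abbreviation T :: "('a \<times> 'a) set" where
  "T \<equiv> (symmetric_basis \<union> {\<one>}) \<times> (symmetric_basis \<union> {\<one>})"

lemma letter_of_symmetric_basis:
  assumes "t \<in> symmetric_basis \<union> {\<one>}"
  shows "\<exists>u\<in>words. length u \<le> 1 \<and> word_value F u = t"
proof -
  consider "t \<in> B" | b where "b \<in> B" "t = inv b" | "t = \<one>"
    using assms unfolding symmetric_basis_def by blast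
  then show ?thesis
  proof cases
    case 1
    with basis_subset show ?thesis
      by (intro bexI[of _ "[(t, True)]"]) (auto simp: letter_value_def)
  next
    case 2
    with basis_subset show ?thesis
      by (intro bexI[of _ "[(b, False)]"]) (auto simp: letter_value_def)
  next
    case 3
    then show ?thesis by (intro bexI[of _ "[]"]) auto
  qed
qed

lemma letter_value_in_symmetric_basis: "fst x \<in> B \<Longrightarrow> letter_value F x \<in> symmetric_basis"
  by (auto simp: letter_value_def symmetric_basis_def)

lemma symmetric_basis_closed: "symmetric_basis \<subseteq> carrier F"
  using basis_subset by (auto simp: symmetric_basis_def)

lemma inv_symmetric_basis: "t \<in> symmetric_basis \<union> {\<one>} \<Longrightarrow> inv t \<in> symmetric_basis \<union> {\<one>}"
  using basis_subset by (auto simp: symmetric_basis_def)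

lemma group_FF: "group FF"
  by (rule DirProd_group) (rule group_axioms)+

lemma T_closed: "T \<subseteq> carrier FF"
  using symmetric_basis_closed by auto

text \<open>The identity among the generators pads a word that has run out of letters, so only a
  bound on the length matters.\<close>

lemma word_split:
  assumes "u \<in> words" "length u \<le> Suc n"
  shows "\<exists>t\<in>symmetric_basis \<union> {\<one>}. \<exists>v\<in>words. length v \<le> n \<and>
    word_value F u = t \<otimes> word_value F v"
proof (cases u)
  case Nil
  then show ?thesis by (intro bexI[of _ \<one>] bexI[of _ "[]"]) auto
next
  case (Cons x v)
  with assms letter_value_in_symmetric_basis[of x] show ?thesis
    by (intro bexI[of _ "letter_value F x"] bexI[of _ v]) auto
qed

text \<open>A single edge advances both coordinates, so the two lengths combine by their maximum and
  not by their sum.\<close>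

lemma cayley_path_of_words:
  assumes "g \<in> carrier FF" "u \<in> words" "v \<in> words" "length u \<le> n" "length v \<le> n"
  shows "(g, g \<otimes>\<^bsub>FF\<^esub> (word_value F u, word_value F v)) \<in> cayley_edges FF T ^^ n"
  using assms
proof (induction n arbitrary: g u v)
  case 0
  then show ?case by auto
next
  case (Suc n)
  obtain s u' where s: "s \<in> symmetric_basis \<union> {\<one>}" "u' \<in> words" "length u' \<le> n"
    "word_value F u = s \<otimes> word_value F u'"
    using word_split[OF Suc.prems(2,4)] by blast
  obtain t v' where t: "t \<in> symmetric_basis \<union> {\<one>}" "v' \<in> words" "length v' \<le> n"
    "word_value F v = t \<otimes> word_value F v'"
    using word_split[OF Suc.prems(3,5)] by blast
  have st: "(s, t) \<in> T" "(s, t) \<in> carrier FF"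
    using s t T_closed by auto
  let ?h = "g \<otimes>\<^bsub>FF\<^esub> (s, t)"
  interpret P: group FF by (rule group_FF)
  have h: "?h \<in> carrier FF" using Suc.prems st by blast
  have "(g, ?h) \<in> cayley_edges FF T"
    using Suc.prems st h unfolding cayley_edges_def by blast
  moreover have "(?h, ?h \<otimes>\<^bsub>FF\<^esub> (word_value F u', word_value F v')) \<in> cayley_edges FF T ^^ n"
    using s t h by (intro Suc.IH) auto
  moreover have "?h \<otimes>\<^bsub>FF\<^esub> (word_value F u', word_value F v') =
      g \<otimes>\<^bsub>FF\<^esub> (word_value F u, word_value F v)"
    using Suc.prems(1) st s t by (subst P.m_assoc) auto
  ultimately show ?case by (metis relpow_Suc_I2)
qed

lemma words_of_cayley_path:
  assumes "g \<in> carrier FF" "(g, h) \<in> cayley_edges FF T ^^ n"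
  obtains u v where "u \<in> words" "v \<in> words" "length u \<le> n" "length v \<le> n"
    "h = g \<otimes>\<^bsub>FF\<^esub> (word_value F u, word_value F v)"
  using assms
proof (induction n arbitrary: h thesis)
  case 0
  then show ?case using "0.prems"(1)[of "[]" "[]"] by auto
next
  case (Suc n)
  interpret P: group FF by (rule group_FF)
  from Suc.prems(3) obtain k where k: "(g, k) \<in> cayley_edges FF T ^^ n" "(k, h) \<in> cayley_edges FF T"
    by auto
  obtain u v where uv: "u \<in> words" "v \<in> words" "length u \<le> n" "length v \<le> n"
    "k = g \<otimes>\<^bsub>FF\<^esub> (word_value F u, word_value F v)"
    using Suc.IH[OF _ Suc.prems(2) k(1)] by blast
  from k(2) obtain t where kh: "k \<in> carrier FF" "h \<in> carrier FF" and t: "t \<in> T"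
    "h = k \<otimes>\<^bsub>FF\<^esub> t \<or> k = h \<otimes>\<^bsub>FF\<^esub> t"
    unfolding cayley_edges_def by blast
  \<comment> \<open>An edge may be traversed against its generator; as \<open>T\<close> is closed
    under inverses, this is a step by the inverse generator.\<close>
  have "\<exists>t\<in>T. h = k \<otimes>\<^bsub>FF\<^esub> t"
    using t(2)
  proof
    assume "k = h \<otimes>\<^bsub>FF\<^esub> t"
    then have "h = k \<otimes>\<^bsub>FF\<^esub> inv\<^bsub>FF\<^esub> t"
      using kh t(1) T_closed by (meson P.inv_solve_right subsetD)
    moreover have "inv\<^bsub>FF\<^esub> t \<in> T"
    proof -
      obtain a b where ab: "t = (a, b)" "a \<in> symmetric_basis \<union> {\<one>}" "b \<in> symmetric_basis \<union> {\<one>}"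
        using t(1) by blast
      then have "a \<in> carrier F" "b \<in> carrier F" using symmetric_basis_closed by auto
      then have "inv\<^bsub>FF\<^esub> t = (inv a, inv b)"
        unfolding ab(1) by (rule inv_DirProd[OF group_axioms group_axioms])
      then show ?thesis
        using inv_symmetric_basis[OF ab(2)] inv_symmetric_basis[OF ab(3)] by (metis SigmaI)
    qed
    ultimately show ?thesis by (rule bexI)
  qed (rule bexI[OF _ t(1)])
  then obtain a b where ab: "a \<in> symmetric_basis \<union> {\<one>}" "b \<in> symmetric_basis \<union> {\<one>}"
    "h = k \<otimes>\<^bsub>FF\<^esub> (a, b)" by (elim bexE SigmaE) simp
  obtain p where p: "p \<in> words" "length p \<le> 1" "word_value F p = a"
    using letter_of_symmetric_basis ab(1) by blast
  obtain q where q: "q \<in> words" "length q \<le> 1" "word_value F q = b"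
    using letter_of_symmetric_basis ab(2) by blast
  have "h = g \<otimes>\<^bsub>FF\<^esub> (word_value F (u @ p), word_value F (v @ q))"
    using p q uv ab Suc.prems(2) by (cases g) (auto simp: word_value_append m_assoc)
  then show ?case using uv p q by (intro Suc.prems(1)[of "u @ p" "v @ q"]) auto
qed

text \<open>Paths can be prolonged by idle steps. This makes the existence of a path of length
  exactly \<open>n\<close> equivalent to the least length being at most \<open>n\<close>.\<close>

lemma cayley_edges_relpow_mono:
  assumes "g \<in> carrier FF" "(g, h) \<in> cayley_edges FF T ^^ m" "m \<le> n"
  shows "(g, h) \<in> cayley_edges FF T ^^ n"
proof -
  obtain u v where "u \<in> words" "v \<in> words" "length u \<le> m" "length v \<le> m"
    "h = g \<otimes>\<^bsub>FF\<^esub> (word_value F u, word_value F v)"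
    using words_of_cayley_path[OF assms(1,2)] by blast
  with assms show ?thesis by (simp only:) (rule cayley_path_of_words, auto)
qed

lemma cayley_dist_le_iff:
  assumes "g \<in> carrier FF" "h \<in> carrier FF"
  shows "cayley_dist FF T g h \<le> real n \<longleftrightarrow>
    (\<exists>u\<in>words. \<exists>v\<in>words. length u \<le> n \<and> length v \<le> n \<and>
      h = g \<otimes>\<^bsub>FF\<^esub> (word_value F u, word_value F v))" (is "_ \<longleftrightarrow> ?R")
proof -
  interpret P: group FF by (rule group_FF)
  let ?Q = "\<lambda>n. (g, h) \<in> cayley_edges FF T ^^ n"
  have "?R \<longleftrightarrow> ?Q n"
    using cayley_path_of_words[OF assms(1)] words_of_cayley_path[OF assms(1)] by metis
  \<comment> \<open>Without any path the \<open>LEAST\<close> would carry no information. Reduced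
    words for the coordinates of g^-1 h provide one.\<close>
  moreover have "\<exists>m. ?Q m"
  proof -
    have "inv\<^bsub>FF\<^esub> g \<otimes>\<^bsub>FF\<^esub> h \<in> carrier FF"
      using assms by (intro P.m_closed P.inv_closed)
    then obtain x y where xy: "inv\<^bsub>FF\<^esub> g \<otimes>\<^bsub>FF\<^esub> h = (x, y)" "x \<in> carrier F" "y \<in> carrier F"
      by auto
    obtain u where u: "u \<in> reduced_words B" "word_value F u = x"
      using exists_reduced_word xy by blast
    obtain v where v: "v \<in> reduced_words B" "word_value F v = y"
      using exists_reduced_word xy by blast
    have "g \<otimes>\<^bsub>FF\<^esub> (x, y) = h"
      unfolding xy(1)[symmetric] using assms
      by (metis P.inv_closed P.l_one P.m_assoc P.r_inv)
    then show ?thesis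
      using cayley_path_of_words[OF assms(1), of u v "max (length u) (length v)"] u v
        reduced_in_words by auto
  qed
  then have "?Q (LEAST n. ?Q n)" by (rule LeastI_ex)
  then have "(LEAST n. ?Q n) \<le> n \<longleftrightarrow> ?Q n"
    using cayley_edges_relpow_mono[OF assms(1)] Least_le[of ?Q n] by blast
  ultimately show ?thesis by (simp add: cayley_dist_def)
qed

section \<open>The quotient pseudo-metric in terms of words\<close>

abbreviation qdist where
  "qdist \<equiv> quotient_dist (\<lambda>g x. g \<otimes>\<^bsub>FF\<^esub> x) (cayley_dist FF T) \<one>\<^bsub>FF\<^esub>"

text \<open>Left multiplication by elements of \<open>N\<close> preserves the right coset
  \<open>C\<close>, so the distance from \<open>N\<close> to \<open>C\<close> can be measured from
  the identity.\<close>

lemma quotient_dist_le_iff: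
  assumes N: "subgroup N FF" and C: "C \<in> rcosets\<^bsub>FF\<^esub> N"
  shows "qdist N C \<le> real n \<longleftrightarrow>
    (\<exists>u\<in>words. \<exists>v\<in>words. length u \<le> n \<and> length v \<le> n \<and> (word_value F u, word_value F v) \<in> C)"
    (is "?L \<longleftrightarrow> ?R")
proof -
  interpret P: group FF by (rule group_FF)
  note NC = subgroup.subset[OF N] subgroup.rcosets_carrier[OF N group_FF C]
  have mult: "inv\<^bsub>FF\<^esub> g \<otimes>\<^bsub>FF\<^esub> h \<in> C" if gh: "g \<in> N" "h \<in> C" for g h
  proof -
    obtain x where "x \<in> carrier FF" "C = N #>\<^bsub>FF\<^esub> x"
      using C unfolding RCOSETS_def by blast
    then have "C = N #>\<^bsub>FF\<^esub> h"
      using gh P.repr_independence[OF _ _ N] by blast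
    moreover have "inv\<^bsub>FF\<^esub> g \<in> N" using N gh by (simp add: subgroup.m_inv_closed)
    ultimately show ?thesis unfolding r_coset_def by blast
  qed
  define X where "X = {cayley_dist FF T (g \<otimes>\<^bsub>FF\<^esub> \<one>\<^bsub>FF\<^esub>) (h \<otimes>\<^bsub>FF\<^esub> \<one>\<^bsub>FF\<^esub>) | g h. g \<in> N \<and> h \<in> C}"
  have X: "X = {cayley_dist FF T g h | g h. g \<in> N \<and> h \<in> C}"
  proof -
    have "g \<otimes>\<^bsub>FF\<^esub> \<one>\<^bsub>FF\<^esub> = g" if "g \<in> N \<or> g \<in> C" for g
      using that NC by (intro P.r_one) blast
    then show ?thesis unfolding X_def by (metis (no_types, lifting))
  qed
  have "N \<noteq> {}" using subgroup.one_closed[OF N] by blast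
  moreover have "C \<noteq> {}" by (rule subgroup.rcosets_non_empty[OF N C])
  ultimately have "X \<noteq> {}" unfolding X by blast
  moreover have "X \<subseteq> \<nat>" unfolding X cayley_dist_def by auto
  \<comment> \<open>Distances are natural numbers, and a non-empty set of naturals attains its
    infimum.\<close>
  ultimately have "Inf X \<in> X" "bdd_below X"
  proof -
    obtain Y :: "nat set" where Y: "X = real ` Y" "Y \<noteq> {}"
      using \<open>X \<subseteq> \<nat>\<close> \<open>X \<noteq> {}\<close> by (metis Nats_def subset_imageE image_is_empty)
    have "Inf X = real (Inf Y)"
      unfolding Y(1) using Y(2) by (intro cInf_eq_minimum) (auto simp: Inf_nat_def1 wellorder_Inf_le1)
    then show "Inf X \<in> X" using Y Inf_nat_def1 by auto
    show "bdd_below X" unfolding Y(1) by (rule bdd_belowI[of _ 0]) auto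
  qed
  then have "Inf X \<le> real n \<longleftrightarrow> (\<exists>x\<in>X. x \<le> real n)"
    by (meson cInf_lower order_trans)
  then have L: "?L \<longleftrightarrow> (\<exists>g\<in>N. \<exists>h\<in>C. cayley_dist FF T g h \<le> real n)"
    unfolding quotient_dist_def X_def[symmetric] unfolding X by blast
  show ?thesis
  proof
    assume ?L
    then obtain g h where gh: "g \<in> N" "h \<in> C" "cayley_dist FF T g h \<le> real n" unfolding L by blast
    then have c: "g \<in> carrier FF" "h \<in> carrier FF" using NC by blast+
    obtain u v where uv: "u \<in> words" "v \<in> words" "length u \<le> n" "length v \<le> n"
      "h = g \<otimes>\<^bsub>FF\<^esub> (word_value F u, word_value F v)"
      using cayley_dist_le_iff[OF c] gh(3) by blast
    then have "(word_value F u, word_value F v) = inv\<^bsub>FF\<^esub> g \<otimes>\<^bsub>FF\<^esub> h"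
      using c by (intro P.inv_solve_left[THEN iffD2]) auto
    with mult gh uv show ?R by metis
  next
    assume ?R
    then obtain u v where uv: "u \<in> words" "v \<in> words" "length u \<le> n" "length v \<le> n"
      "(word_value F u, word_value F v) \<in> C" by blast
    have "cayley_dist FF T \<one>\<^bsub>FF\<^esub> (word_value F u, word_value F v) \<le> real n"
      using uv NC by (subst cayley_dist_le_iff) (auto intro!: bexI[of _ u] bexI[of _ v])
    then show ?L unfolding L using uv subgroup.one_closed[OF N] by blast
  qed
qed

text \<open>As for paths, one generator removes a letter from both coordinates, and the identity
  fills up the shorter word.\<close>

lemma generate_T: "generate FF T = carrier FF"
proof
  interpret P: group FF by (rule group_FF)
  show "generate FF T \<subseteq> carrier FF" by (rule P.generate_incl[OF T_closed])
  have *: "(word_value F u, word_value F v) \<in> generate FF T"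
    if "u \<in> words" "v \<in> words" "length u \<le> n" "length v \<le> n" for u v n
    using that
  proof (induction n arbitrary: u v)
    case 0
    then show ?case using generate.one[of FF T] by auto
  next
    case (Suc n)
    obtain s u' where s: "s \<in> symmetric_basis \<union> {\<one>}" "u' \<in> words" "length u' \<le> n"
      "word_value F u = s \<otimes> word_value F u'"
      using word_split[OF Suc.prems(1,3)] by blast
    obtain t v' where t: "t \<in> symmetric_basis \<union> {\<one>}" "v' \<in> words" "length v' \<le> n"
      "word_value F v = t \<otimes> word_value F v'"
      using word_split[OF Suc.prems(2,4)] by blast
    have "(s, t) \<otimes>\<^bsub>FF\<^esub> (word_value F u', word_value F v') \<in> generate FF T"
    proof (rule generate.eng)
      show "(s, t) \<in> generate FF T" using s t by (intro generate.incl SigmaI)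
      show "(word_value F u', word_value F v') \<in> generate FF T" using s t Suc.IH by blast
    qed
    with s t show ?case by simp
  qed
  show "carrier FF \<subseteq> generate FF T"
  proof
    fix g assume "g \<in> carrier FF"
    then obtain x y where xy: "g = (x, y)" "x \<in> carrier F" "y \<in> carrier F" by auto
    obtain u where u: "u \<in> reduced_words B" "word_value F u = x"
      using exists_reduced_word xy by blast
    obtain v where v: "v \<in> reduced_words B" "word_value F v = y"
      using exists_reduced_word xy by blast
    show "g \<in> generate FF T"
      using *[of u v "max (length u) (length v)"] u v xy reduced_in_words by auto
  qed
qed

section \<open>Growth of quotients\<close>

abbreviation growth where
  "growth \<equiv> quotient_growth_exponent FF (\<lambda>g x. g \<otimes>\<^bsub>FF\<^esub> x) (cayley_dist FF T) \<one>\<^bsub>FF\<^esub>"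

text \<open>With q = 2 card B - 1, pairs of reduced words of length n give at least q^(2n) distinct
  elements of the ball of radius n.\<close>

lemma growth_exponent_trivial_ge:
  "ereal (2 * ln (2 * card B - 1)) \<le> growth {\<one>\<^bsub>FF\<^esub>}"
proof -
  interpret P: group FF by (rule group_FF)
  define q where "q = 2 * card B - 1"
  have q: "1 \<le> q" "real q = 2 * card B - 1" "q \<le> 2 * card B"
    using two_le_rank by (auto simp: q_def of_nat_diff)
  let ?N = "{\<one>\<^bsub>FF\<^esub>}"
  let ?ball = "\<lambda>n. {C \<in> rcosets\<^bsub>FF\<^esub> ?N. qdist ?N C \<le> real n}"
  have N: "subgroup ?N FF" by (rule P.triv_subgroup)
  \<comment> \<open>Cosets of the trivial subgroup are singletons, so the balls of the quotient are
    those of the group.\<close>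
  have coset: "?N #>\<^bsub>FF\<^esub> g = {g}" if "g \<in> carrier FF" for g
    using P.l_one[OF that] by (simp add: r_coset_def)
  have card: "(real q * real q) ^ n \<le> card (?ball n)" if fin: "finite (?ball n)" for n
  proof -
    let ?R = "{u \<in> reduced_words B. length u = n}"
    let ?f = "\<lambda>(u, v). {(word_value F u, word_value F v)}"
    have "inj_on ?f (?R \<times> ?R)"
      using inj_onD[OF word_value_inj_on] by (auto simp: inj_on_def)
    moreover have "?f ` (?R \<times> ?R) \<subseteq> ?ball n"
    proof
      fix C assume "C \<in> ?f ` (?R \<times> ?R)"
      then obtain u v where uv: "u \<in> ?R" "v \<in> ?R" "C = {(word_value F u, word_value F v)}"
        by auto
      then have w: "u \<in> words" "v \<in> words" using reduced_in_words by blast+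
      then have "(word_value F u, word_value F v) \<in> carrier FF" by simp
      then have C: "C \<in> rcosets\<^bsub>FF\<^esub> ?N"
        using coset uv(3) unfolding RCOSETS_def by blast
      then have "qdist ?N C \<le> real n"
        using uv w unfolding quotient_dist_le_iff[OF N C]
        by (intro bexI[of _ u] bexI[of _ v]) simp_all
      with C show "C \<in> ?ball n" by blast
    qed
    ultimately have le: "card (?R \<times> ?R) \<le> card (?ball n)"
      using fin by (rule card_inj_on_le)
    \<comment> \<open>For positive \<open>n\<close> there are (q + 1) q^(n-1) such words; for n = 0
      there is just the empty one.\<close>
    have "q ^ n \<le> card ?R"
    proof (cases n)
      case 0
      then have "?R = {[]}" by auto
      then show ?thesis using 0 by simp
    next
      case (Suc m)
      have "q * q ^ m \<le> 2 * card B * q ^ m" using q(3) by (rule mult_le_mono1)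
      then show ?thesis
        using card_reduced_words_length(2)[OF finite_basis, of m]
        unfolding Suc q_def[symmetric] by simp
    qed
    then have "q ^ n * q ^ n \<le> card ?R * card ?R" by (intro mult_le_mono)
    also have "\<dots> = card (?R \<times> ?R)" by (rule card_cartesian_product[symmetric])
    also note le
    finally have "q ^ n * q ^ n \<le> card (?ball n)" .
    then have "real (q ^ n * q ^ n) \<le> real (card (?ball n))" by (simp only: of_nat_le_iff)
    then show ?thesis by (simp add: power_mult_distrib)
  qed
  have "ereal (ln (real q * real q)) \<le> growth_exponent (rcosets\<^bsub>FF\<^esub> ?N) qdist ?N"
  proof (rule growth_exponent_ge)
    show "1 \<le> real q * real q" using q(1) by (intro mult_ge1_I) simp_all
  qed (rule card)
  then show ?thesis
    using q by (simp add: quotient_growth_exponent_def FactGroup_def ln_mult)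
qed

text \<open>Here and below \<open>e\<close> is the identity or the swap, so that one argument covers both factors.
  A shortest word representing the relevant coordinate of a coset cannot contain \<open>w\<close>:
  deleting \<open>w\<close> multiplies by a conjugate of an element of \<open>N\<close>.\<close>

lemma quotient_ball_subset:
  assumes N: "N \<lhd> FF" and e: "e = (\<lambda>z. z) \<or> e = prod.swap"
    and w: "w \<in> reduced_words B" "w \<noteq> []" "e (word_value F w, \<one>) \<in> N"
  shows "{C \<in> rcosets\<^bsub>FF\<^esub> N. qdist N C \<le> real n} \<subseteq>
    (\<lambda>(u, v). N #>\<^bsub>FF\<^esub> e (word_value F u, word_value F v)) `
      ((\<Union>i\<le>n. avoiding_words B w i) \<times> (\<Union>i\<le>n. {v \<in> reduced_words B. length v = i}))"
proof
  interpret P: group FF by (rule group_FF)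
  have sub: "subgroup N FF" using N by (rule normal_imp_subgroup)
  have e_mult: "e (x, y) \<otimes>\<^bsub>FF\<^esub> e (x', y') = e (x \<otimes> x', y \<otimes> y')" for x y x' y'
    using e by auto
  have e_closed: "e (x, y) \<in> carrier FF \<longleftrightarrow> x \<in> carrier F \<and> y \<in> carrier F" for x y
    using e by auto
  have e_inv: "inv\<^bsub>FF\<^esub> e (x, y) = e (inv x, inv y)" if "x \<in> carrier F" "y \<in> carrier F" for x y
    using e inv_DirProd[OF group_axioms group_axioms that]
      inv_DirProd[OF group_axioms group_axioms that(2,1)] by auto
  fix C assume "C \<in> {C \<in> rcosets\<^bsub>FF\<^esub> N. qdist N C \<le> real n}"
  then have C: "C \<in> rcosets\<^bsub>FF\<^esub> N" "qdist N C \<le> real n" by auto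
  obtain g where g: "g \<in> carrier FF" "C = N #>\<^bsub>FF\<^esub> g"
    using C(1) unfolding RCOSETS_def by blast
  have C_carrier: "C \<subseteq> carrier FF" by (rule subgroup.rcosets_carrier[OF sub group_FF C(1)])
  have mult: "m \<otimes>\<^bsub>FF\<^esub> c \<in> C" if "m \<in> N" "c \<in> C" for m c
  proof -
    have "C = N #>\<^bsub>FF\<^esub> c" using that g P.repr_independence[OF _ _ sub] by blast
    with that(1) show ?thesis unfolding r_coset_def by blast
  qed
  have "\<exists>u\<in>words. \<exists>v\<in>words. length u \<le> n \<and> length v \<le> n \<and> e (word_value F u, word_value F v) \<in> C"
    using C(2) e unfolding quotient_dist_le_iff[OF sub C(1)] by (elim disjE) auto
  then obtain u0 v0 where uv0: "u0 \<in> words" "v0 \<in> words" "length u0 \<le> n" "length v0 \<le> n"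
    "e (word_value F u0, word_value F v0) \<in> C" by blast
  \<comment> \<open>The other coordinate stays at \<open>v0\<close> during this minimisation,
    matching the deletion below, which alters one coordinate only.\<close>
  obtain u where u: "u \<in> reduced_words B" "word_value F u \<in> {x. e (x, word_value F v0) \<in> C}"
      "length u \<le> length u0"
    and min: "\<And>v. v \<in> words \<Longrightarrow> word_value F v \<in> {x. e (x, word_value F v0) \<in> C} \<Longrightarrow>
      length u \<le> length v"
    using shortest_word[OF uv0(1), of "{x. e (x, word_value F v0) \<in> C}"] uv0(5) by blast
  \<comment> \<open>With \<open>u\<close> fixed, this replaces \<open>v0\<close> by a reduced word
    that is no longer.\<close>
  obtain v where v: "v \<in> reduced_words B" "word_value F v \<in> {y. e (word_value F u, y) \<in> C}"
      "length v \<le> length v0"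
    using shortest_word[OF uv0(2), of "{y. e (word_value F u, y) \<in> C}"] u(2) by blast
  have "\<not> sublist w u"
  proof
    assume "sublist w u"
    then obtain a b where ab: "u = a @ w @ b" unfolding sublist_def by blast
    have words: "a \<in> words" "b \<in> words" "w \<in> words"
      using reduced_in_words[OF u(1)] ab by auto
    let ?a = "word_value F a" and ?b = "word_value F b" and ?w = "word_value F w"
      and ?y = "word_value F v0"
    have cl: "?a \<in> carrier F" "?b \<in> carrier F" "?w \<in> carrier F" "?y \<in> carrier F"
      using words uv0 by auto
    have "e (?a, \<one>) \<in> carrier FF" unfolding e_closed using cl by simp
    then have "e (?a, \<one>) \<otimes>\<^bsub>FF\<^esub> e (?w, \<one>) \<otimes>\<^bsub>FF\<^esub> inv\<^bsub>FF\<^esub> e (?a, \<one>) \<in> N"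
      using w(3) by (rule normal.inv_op_closed2[OF N])
    then have "e (?a \<otimes> ?w \<otimes> inv ?a, \<one>) \<in> N"
      using cl by (simp add: e_mult e_inv)
    then have "inv\<^bsub>FF\<^esub> e (?a \<otimes> ?w \<otimes> inv ?a, \<one>) \<in> N"
      by (rule subgroup.m_inv_closed[OF sub])
    moreover have "e (word_value F u, ?y) \<in> C" using u(2) by simp
    ultimately have
      "inv\<^bsub>FF\<^esub> e (?a \<otimes> ?w \<otimes> inv ?a, \<one>) \<otimes>\<^bsub>FF\<^esub> e (word_value F u, ?y) \<in> C"
      by (rule mult)
    \<comment> \<open>Since u = a w b = (a w a^-1)(a b), removing the conjugate on the left leaves
      the value of the shorter word \<open>a @ b\<close>.\<close>
    moreover have "inv (?a \<otimes> ?w \<otimes> inv ?a) \<otimes> word_value F u = word_value F (a @ b)"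
    proof -
      have "word_value F u = ?a \<otimes> ?w \<otimes> ?b"
        using ab words by (simp add: word_value_append m_assoc image_Un)
      also have "\<dots> = (?a \<otimes> ?w \<otimes> inv ?a) \<otimes> (?a \<otimes> ?b)"
        using cl by (simp add: m_assoc) (simp add: m_assoc[symmetric])
      finally show ?thesis
        using cl words by (simp add: word_value_append inv_solve_left')
    qed
    ultimately have "e (word_value F (a @ b), ?y) \<in> C"
      using cl by (simp add: e_mult e_inv)
    then have "length u \<le> length (a @ b)" using words by (intro min) auto
    with ab w(2) show False by simp
  qed
  then have "u \<in> avoiding_words B w (length u)" "v \<in> {v' \<in> reduced_words B. length v' = length v}"
    using u v by (auto simp: avoiding_words_def)
  moreover have "length u \<le> n" "length v \<le> n" using u v uv0 by auto
  ultimately have "(u, v) \<in> (\<Union>i\<le>n. avoiding_words B w i) \<times>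
      (\<Union>i\<le>n. {v \<in> reduced_words B. length v = i})"
    by blast
  moreover have "C = N #>\<^bsub>FF\<^esub> e (word_value F u, word_value F v)"
    using v(2) g P.repr_independence[OF _ _ sub] by blast
  ultimately show "C \<in> (\<lambda>(u, v). N #>\<^bsub>FF\<^esub> e (word_value F u, word_value F v)) `
      ((\<Union>i\<le>n. avoiding_words B w i) \<times> (\<Union>i\<le>n. {v \<in> reduced_words B. length v = i}))"
    by (intro rev_image_eqI[of "(u, v)"]) auto
qed

text \<open>One coordinate grows at rate \<rho> and the other at rate q, so the ball of radius n has
  at most a polynomial in n times (\<rho> q)^n elements.\<close>

lemma growth_less:
  assumes N: "N \<lhd> FF" and e: "e = (\<lambda>z. z) \<or> e = prod.swap"
    and a: "a \<in> carrier F" "a \<noteq> \<one>" "e (a, \<one>) \<in> N"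
  shows "growth N < ereal (2 * ln (2 * card B - 1))"
proof -
  obtain w where w: "w \<in> reduced_words B" "word_value F w = a"
    using exists_reduced_word a(1) by blast
  with a(2) have ne: "w \<noteq> []" by auto
  define q where "q = 2 * card B - 1"
  have q: "3 \<le> q" "real q = 2 * card B - 1" "2 * card B = Suc q"
    using two_le_rank by (auto simp: q_def of_nat_diff)
  obtain K \<rho> :: real where K: "1 \<le> K" "1 \<le> \<rho>" "\<rho> < real q"
    "\<And>n. card (avoiding_words B w n) \<le> K * \<rho> ^ n"
    using card_avoiding_words_bound[OF finite_basis two_le_rank w(1) ne] q(2) by metis
  let ?A = "\<lambda>n. \<Union>i\<le>n. avoiding_words B w i"
  let ?R = "\<lambda>n. \<Union>i\<le>n. {v \<in> reduced_words B. length v = i}"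
  let ?ball = "\<lambda>n. {C \<in> rcosets\<^bsub>FF\<^esub> N. qdist N C \<le> real n}"
  let ?K = "K * (real q + 1)"
  have fin: "finite (?A n \<times> ?R n)" for n
    using finite_avoiding_words[OF finite_basis] finite_reduced_words_length[OF finite_basis]
    by blast
  note ball = quotient_ball_subset[OF N e w(1) ne, unfolded w(2), OF a(3)]
  have card: "card (?ball n) \<le> ?K * (real n + 1) ^ 2 * (\<rho> * real q) ^ n" for n
  proof -
    \<comment> \<open>The factor q + 1 is the number of letters; it also covers the empty
      word.\<close>
    have "card {v \<in> reduced_words B. length v = i} \<le> (real q + 1) * real q ^ i" for i
    proof (cases i)
      case 0
      then have "{v \<in> reduced_words B. length v = i} = {[]}" by auto
      with 0 show ?thesis by simp
    next
      case (Suc m)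
      have "real (card {v \<in> reduced_words B. length v = i}) = (real q + 1) * real q ^ m"
        using card_reduced_words_length(2)[OF finite_basis, of m] Suc q(3) by (simp add: distrib_right)
      also have "\<dots> \<le> (real q + 1) * real q ^ i"
        using q Suc by (intro mult_left_mono power_increasing) auto
      finally show ?thesis .
    qed
    then have R: "card (?R n) \<le> (real q + 1) * (real n + 1) * real q ^ n"
      by (rule card_UN_le_geometric) (use q in simp_all)
    have A: "card (?A n) \<le> K * (real n + 1) * \<rho> ^ n"
      using K(4) by (rule card_UN_le_geometric) (use K in simp_all)
    have "card (?ball n) \<le> card (?A n \<times> ?R n)"
      by (rule surj_card_le[OF fin ball])
    then have "real (card (?ball n)) \<le> real (card (?A n)) * real (card (?R n))"
      by (simp only: card_cartesian_product of_nat_mult[symmetric] of_nat_le_iff)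
    also have "\<dots> \<le> (K * (real n + 1) * \<rho> ^ n) * ((real q + 1) * (real n + 1) * real q ^ n)"
      using A R K by (intro mult_mono) auto
    also have "\<dots> = ?K * (real n + 1) ^ 2 * (\<rho> * real q) ^ n"
      by (simp only: power_mult_distrib power2_eq_square mult_ac)
    finally show ?thesis .
  qed
  have "growth_exponent (rcosets\<^bsub>FF\<^esub> N) qdist N \<le> ereal (ln (\<rho> * real q))"
  proof (rule growth_exponent_le)
    show "1 \<le> ?K" by (rule mult_ge1_I) (use K in simp_all)
    show "1 \<le> \<rho> * real q" by (rule mult_ge1_I) (use K(2) q(1) in simp_all)
    show "finite (?ball n)" for n
      by (rule finite_subset[OF ball]) (intro finite_imageI fin)
  qed (rule card)
  also have "ln (\<rho> * real q) = ln \<rho> + ln (real q)"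
    using K(2) q(1) by (simp add: ln_mult)
  \<comment> \<open>This is the source of strictness; passing to the limit superior preserves weak
    inequalities only.\<close>
  also have "ln \<rho> < ln (real q)" using K by simp
  then have "ereal (ln \<rho> + ln (real q)) < ereal (2 * ln (real q))" by simp
  finally show ?thesis
    using q(2) by (simp add: quotient_growth_exponent_def FactGroup_def)
qed

text \<open>The commutator of \<open>(x, y) \<in> N\<close> with \<open>(c, 1)\<close> lies in the first factor.\<close>

lemma normal_subgroup_meets_factor:
  assumes N: "N \<lhd> FF" and e: "e = (\<lambda>z. z) \<or> e = prod.swap"
    and xy: "e (x, y) \<in> N" "x \<noteq> \<one>"
  obtains a where "a \<in> carrier F" "a \<noteq> \<one>" "e (a, \<one>) \<in> N"
proof -
  have sub: "subgroup N FF" using N by (rule normal_imp_subgroup)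
  have "e (x, y) \<in> carrier FF" using subgroup.subset[OF sub] xy(1) by (rule subsetD)
  with e have cl: "x \<in> carrier F" "y \<in> carrier F" by auto
  obtain c where c: "c \<in> carrier F" "c \<otimes> x \<noteq> x \<otimes> c"
    using center_trivial[OF cl(1) xy(2)] by blast
  have e_mult: "e (x, y) \<otimes>\<^bsub>FF\<^esub> e (x', y') = e (x \<otimes> x', y \<otimes> y')" for x y x' y'
    using e by auto
  have e_inv: "inv\<^bsub>FF\<^esub> e (x, y) = e (inv x, inv y)" if "x \<in> carrier F" "y \<in> carrier F" for x y
    using e inv_DirProd[OF group_axioms group_axioms that]
      inv_DirProd[OF group_axioms group_axioms that(2,1)] by auto
  have "e (c, \<one>) \<in> carrier FF" using c e by auto
  then have "e (c, \<one>) \<otimes>\<^bsub>FF\<^esub> e (x, y) \<otimes>\<^bsub>FF\<^esub> inv\<^bsub>FF\<^esub> e (c, \<one>) \<in> N"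
    using xy(1) by (rule normal.inv_op_closed2[OF N])
  moreover have "inv\<^bsub>FF\<^esub> e (x, y) \<in> N" by (rule subgroup.m_inv_closed[OF sub xy(1)])
  ultimately have "e (c, \<one>) \<otimes>\<^bsub>FF\<^esub> e (x, y) \<otimes>\<^bsub>FF\<^esub> inv\<^bsub>FF\<^esub> e (c, \<one>) \<otimes>\<^bsub>FF\<^esub> inv\<^bsub>FF\<^esub> e (x, y) \<in> N"
    by (rule subgroup.m_closed[OF sub])
  then have "e (c \<otimes> x \<otimes> inv c \<otimes> inv x, \<one>) \<in> N"
    using c cl by (simp add: e_mult e_inv)
  moreover have "c \<otimes> x \<otimes> inv c \<otimes> inv x \<noteq> \<one>"
  proof
    assume "c \<otimes> x \<otimes> inv c \<otimes> inv x = \<one>"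
    then have "c \<otimes> x \<otimes> inv c = x"
      using c cl by (metis inv_closed inv_equality inv_inv m_closed)
    then have "c \<otimes> x = x \<otimes> c"
      using c cl by (metis inv_solve_right' m_closed)
    with c show False by simp
  qed
  ultimately show ?thesis using c cl by (intro that) auto
qed

lemma growth_tight: "growth_tight_wrt FF T"
proof -
  have "growth N < growth {\<one>\<^bsub>FF\<^esub>}" if N: "N \<lhd> FF" "infinite N" for N
  proof -
    obtain z where z: "z \<in> N" "z \<noteq> (\<one>, \<one>)"
      using N(2) by (metis finite.emptyI finite_insert finite_subset insertI1 subsetI)
    have "growth N < ereal (2 * ln (2 * card B - 1))"
    \<comment> \<open>Some coordinate of \<open>z\<close> is nontrivial, and \<open>e\<close> is
      chosen so as to put it first.\<close>
    proof (cases "fst z = \<one>")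
      case False
      have "(\<lambda>z. z) (fst z, snd z) \<in> N" using z by simp
      then obtain a where "a \<in> carrier F" "a \<noteq> \<one>" "(\<lambda>z. z) (a, \<one>) \<in> N"
        using normal_subgroup_meets_factor[OF N(1) disjI1[OF refl] _ False] by blast
      then show ?thesis by (rule growth_less[OF N(1) disjI1[OF refl]])
    next
      case True
      with z have ne: "snd z \<noteq> \<one>" by (auto simp: prod_eq_iff)
      have "prod.swap (snd z, fst z) \<in> N" using z by simp
      then obtain a where "a \<in> carrier F" "a \<noteq> \<one>" "prod.swap (a, \<one>) \<in> N"
        using normal_subgroup_meets_factor[OF N(1) disjI2[OF refl] _ ne] by blast
      then show ?thesis by (rule growth_less[OF N(1) disjI2[OF refl]])
    qed
    with growth_exponent_trivial_ge show ?thesis by (rule less_le_trans[rotated])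
  qed
  moreover have "finite T" using finite_basis by (simp add: symmetric_basis_def)
  ultimately show ?thesis
    unfolding growth_tight_wrt_def growth_tight_action_def
    using T_closed generate_T by blast
qed

end

section \<open>The rank of a non-abelian free group\<close>

lemma (in group) free_basis_nonabelian_card:
  assumes B: "free_basis G B" "finite B" and nc: "\<not> comm_group G"
  shows "2 \<le> card B"
proof (rule ccontr)
  assume "\<not> 2 \<le> card B"
  then have "card B \<le> 1" by simp
  have BG: "B \<subseteq> carrier G" using B by (simp add: free_basis_def)
  \<comment> \<open>Commuting with the basis passes to inverses and products. This is applied twice:
    first to a basis element, which shows that it is central, then to an arbitrary element.\<close>
  have comm: "g \<otimes> word_value G w = word_value G w \<otimes> g \<and> word_value G w \<in> carrier G"
    if g: "g \<in> carrier G" "\<And>b. b \<in> B \<Longrightarrow> g \<otimes> b = b \<otimes> g" and w: "fst ` set w \<subseteq> B" for g w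
    using w
  proof (induction w)
    case (Cons x w)
    then have b: "fst x \<in> B" "fst x \<in> carrier G" using BG by auto
    then have l: "letter_value G x \<in> carrier G" by (simp add: letter_value_def)
    have "g \<otimes> inv (fst x) = inv (fst x) \<otimes> g"
      using g(1) g(2)[OF b(1)] b(2) by (metis inv_closed inv_solve_left inv_solve_right m_assoc m_closed)
    with g(2)[OF b(1)] have "g \<otimes> letter_value G x = letter_value G x \<otimes> g"
      by (simp add: letter_value_def)
    moreover have "word_value G w \<in> carrier G" "g \<otimes> word_value G w = word_value G w \<otimes> g"
      using Cons by auto
    ultimately have "g \<otimes> (letter_value G x \<otimes> word_value G w) =
        letter_value G x \<otimes> word_value G w \<otimes> g"
      using l g(1) by (metis m_assoc)
    with \<open>word_value G w \<in> carrier G\<close> l show ?case by simp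
  qed (use g in simp)
  have ex: "\<exists>w. fst ` set w \<subseteq> B \<and> word_value G w = g" if "g \<in> carrier G" for g
    using that B unfolding free_basis_def reduced_words_def by blast
  have central: "g \<otimes> b = b \<otimes> g" if "g \<in> carrier G" "b \<in> B" for g b
  proof -
    have "b \<otimes> c = c \<otimes> b" if "c \<in> B" for c
      using \<open>card B \<le> 1\<close> B(2) \<open>b \<in> B\<close> that by (metis card_le_Suc0_iff_eq One_nat_def)
    with comm[of b] ex[OF that(1)] BG that show ?thesis by (metis subsetD)
  qed
  have "g \<otimes> h = h \<otimes> g" if "g \<in> carrier G" "h \<in> carrier G" for g h
    using comm[of g] central ex[OF that(2)] that by metis
  then have "comm_group G" by (intro group_comm_groupI)
  with nc show False by simp
qed

theorem corollary1p4:
  fixes F :: "('a, 'b) monoid_scheme" and S :: "'a set"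
  assumes "finite_rank_free_group F"
    and "\<not> comm_group F"
    and "finite S"
    and "symmetric_free_generating_set F S"
  shows "growth_tight_wrt (F \<times>\<times> F) ((S \<union> {\<one>\<^bsub>F\<^esub>}) \<times> (S \<union> {\<one>\<^bsub>F\<^esub>}))"
proof -
  interpret group F using assms(1) by (simp add: finite_rank_free_group_def)
  \<comment> \<open>The basis underlying \<open>S\<close> is the one to work with, as its
    \<open>symmetric_basis\<close> is then \<open>S\<close> itself.\<close>
  obtain B where B: "free_basis F B" "S = B \<union> (\<lambda>b. inv\<^bsub>F\<^esub> b) ` B"
    using assms(4) by (auto simp: symmetric_free_generating_set_def)
  have fin: "finite B" using assms(3) B(2) by simp
  interpret free_group_on_finite_basis F B
    using B(1) fin free_basis_nonabelian_card[OF B(1) fin assms(2)] by unfold_locales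
  show ?thesis using growth_tight unfolding symmetric_basis_def B(2) .
qed

end
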